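(* For $n\ge1$, $$|\mathrm{AC}_n\cap L_n|=\sum_{\substack{1\le k\le n\\ k\ \mathrm{odd}}}\binom nk\,3^{k-1}4^{n-k}=\frac{7^n-1}{6}.$$ The first values (for $n=1,\dots,8$) are $1,8,57,400,2801,19608,137257,960800$.
   Context: $\Delta_n=\{i,j,k,e\}^n$ is the set of words $b=b_1b_2\cdots b_n$ of length $n$ in the four symbols $i,j,k,e$. Words multiply coordinatewise as quaternions ($e$ the identity, $i^2=j^2=k^2=-e$, $ij=k$, $jk=i$, $ki=j$, distinct elements of $\{i,j,k\}$ anticommute), with local signs collected into one global sign, giving an element of $\{\pm b: b\in\Delta_n\}$. Put $v(i)=(\cos 210^\circ,\sin 210^\circ)$, $v(j)=(\cos 90^\circ,\sin 90^\circ)$, $v(k)=(\cos 330^\circ,\sin 330^\circ)$, $v(e)=(0,0)$ in $\mathbb R^2$. Fix a real $d_1>0$ and put $d_r=d_1/2^{r-1}$. The centroid map $P:\Delta_n\to\mathbb R^2$ is $$P(b)=\sum_{r=1}^n \sigma_r(b)\,d_r\,v(b_r),\qquad \sigma_r(b)=(-1)^{\#\{s<r:\ b_s=e\}}.$$ $E_n$ is the set of unordered triples $\{b_1,b_2,b_3\}$ of distinct words in $\Delta_n$ such that $P(b_1),P(b_2),P(b_3)$ are the vertices of a nondegenerate equilateral triangle. $\mathrm{AC}_n$ is the set of $T=\{b_1,b_2,b_3\}\in E_n$ with $b_1b_2=-b_2b_1$, $b_1b_3=-b_3b_1$, $b_2b_3=-b_3b_2$. For $b\in\Delta_n$ put $\mathrm{supp}(b)=\{r: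 b_r\ne e\}$. Let $\gamma$ be the permutation $i\mapsto j\mapsto k\mapsto i$, $e\mapsto e$. For nonempty $S\subseteq\mathrm{supp}(b)$, $\gamma_S(b)$ is obtained by applying $\gamma$ in the coordinates of $S$ and fixing the others, and $T(b,S)=\{b,\gamma_S(b),\gamma_S^2(b)\}$, which is always an element of $E_n$. The local class is $L_n=\{T(b,S): b\in\Delta_n,\ \varnothing\ne S\subseteq\mathrm{supp}(b)\}\subseteq E_n$. *)

theory Defs
  imports "HOL-Analysis.Analysis"
begin

datatype sym = Qi | Qj | Qk | Qe

type_synonym word = "sym list"

text \<open>Coordinates of words are numbered from 0: the coordinate \<open>b\<^sub>r\<close> of the paper
  (\<open>1 \<le> r \<le> n\<close>) is \<open>b ! (r - 1)\<close>.\<close>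

definition Delta :: "nat \<Rightarrow> word set" where
  "Delta n = {b. length b = n}"

text \<open>The product of two symbols as quaternion units; the pair \<open>(s, c)\<close> stands for the
  signed unit \<open>s c\<close> with \<open>s = 1\<close> or \<open>s = -1\<close>.\<close>

fun sym_mult :: "sym \<Rightarrow> sym \<Rightarrow> int \<times> sym" where
  "sym_mult Qe a = (1, a)"
| "sym_mult a Qe = (1, a)"
| "sym_mult Qi Qi = (-1, Qe)"
| "sym_mult Qj Qj = (-1, Qe)"
| "sym_mult Qk Qk = (-1, Qe)"
| "sym_mult Qi Qj = (1, Qk)"
| "sym_mult Qj Qk = (1, Qi)"
| "sym_mult Qk Qi = (1, Qj)"
| "sym_mult Qj Qi = (-1, Qk)"
| "sym_mult Qk Qj = (-1, Qi)"
| "sym_mult Qi Qk = (-1, Qj)"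

definition word_mult :: "word \<Rightarrow> word \<Rightarrow> int \<times> word" where
  "word_mult a b =
     (prod_list (map2 (\<lambda>x y. fst (sym_mult x y)) a b), map2 (\<lambda>x y. snd (sym_mult x y)) a b)"

definition signed_neg :: "int \<times> word \<Rightarrow> int \<times> word" where
  "signed_neg p = (- fst p, snd p)"

definition anticommute :: "word \<Rightarrow> word \<Rightarrow> bool" where
  "anticommute a b \<longleftrightarrow> word_mult a b = signed_neg (word_mult b a)"

fun v :: "sym \<Rightarrow> real^2" where
  "v Qi = vector [cos (210 * pi / 180), sin (210 * pi / 180)]"
| "v Qj = vector [cos (90 * pi / 180), sin (90 * pi / 180)]"
| "v Qk = vector [cos (330 * pi / 180), sin (330 * pi / 180)]"
| "v Qe = 0"

definition sgn_at :: "word \<Rightarrow> nat \<Rightarrow> real" where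
  "sgn_at b r = (-1) ^ card {s. s < r \<and> b ! s = Qe}"

text \<open>With 0-based coordinates the scale \<open>d\<^sub>r = d\<^sub>1 / 2\<^sup>r\<^sup>-\<^sup>1\<close> becomes \<open>d1 / 2 ^ r\<close>.\<close>

definition centroid :: "real \<Rightarrow> word \<Rightarrow> real^2" where
  "centroid d1 b = (\<Sum>r<length b. (sgn_at b r * (d1 / 2 ^ r)) *\<^sub>R v (b ! r))"

definition equilateral :: "real^2 \<Rightarrow> real^2 \<Rightarrow> real^2 \<Rightarrow> bool" where
  "equilateral p q r \<longleftrightarrow> p \<noteq> q \<and> dist p q = dist q r \<and> dist q r = dist r p"

definition Eset :: "real \<Rightarrow> nat \<Rightarrow> word set set" where
  "Eset d1 n = {{b1, b2, b3} | b1 b2 b3.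
     b1 \<in> Delta n \<and> b2 \<in> Delta n \<and> b3 \<in> Delta n \<and>
     b1 \<noteq> b2 \<and> b1 \<noteq> b3 \<and> b2 \<noteq> b3 \<and>
     equilateral (centroid d1 b1) (centroid d1 b2) (centroid d1 b3)}"

definition AC :: "real \<Rightarrow> nat \<Rightarrow> word set set" where
  "AC d1 n = {T \<in> Eset d1 n. \<exists>b1 b2 b3. T = {b1, b2, b3} \<and>
     anticommute b1 b2 \<and> anticommute b1 b3 \<and> anticommute b2 b3}"

definition supp :: "word \<Rightarrow> nat set" where
  "supp b = {r. r < length b \<and> b ! r \<noteq> Qe}"

fun gamma :: "sym \<Rightarrow> sym" where
  "gamma Qi = Qj"
| "gamma Qj = Qk"
| "gamma Qk = Qi"
| "gamma Qe = Qe"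

definition gamma_on :: "nat set \<Rightarrow> word \<Rightarrow> word" where
  "gamma_on S b = map (\<lambda>r. if r \<in> S then gamma (b ! r) else b ! r) [0..<length b]"

definition local_triple :: "word \<Rightarrow> nat set \<Rightarrow> word set" where
  "local_triple b S = {b, gamma_on S b, gamma_on S (gamma_on S b)}"

definition Lset :: "nat \<Rightarrow> word set set" where
  "Lset n = {local_triple b S | b S. b \<in> Delta n \<and> S \<noteq> {} \<and> S \<subseteq> supp b}"

end

theory Submission imports Defs begin

text \<open>The local map \<open>\<gamma>\<^sub>S\<close> changes a word \<open>b\<close> exactly in the coordinates of
  \<open>S \<subseteq> supp b\<close>, and there it turns a quaternion unit into a different imaginary unit, with which it
  anticommutes. Swapping \<open>b\<close> and \<open>\<gamma>\<^sub>S b\<close> therefore costs the sign \<open>(-1) ^ card S\<close>. Since \<open>\<gamma>\<^sub>S\<close> has order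
  three, every two members of a local triple are related by \<open>\<gamma>\<^sub>S\<close>, and the triple is anticommuting if
  and only if \<open>card S\<close> is odd (\<open>anticommute_in_local_triple\<close>).

  That a local triple is equilateral has a geometric reason. The three vectors \<open>v\<close> of the
  imaginary units are permuted by the rotation by \<open>-120\<close> degrees in the same way as \<open>\<gamma>\<close> permutes the
  units, and \<open>\<gamma>\<^sub>S\<close> leaves the signs in the centroid untouched. So \<open>\<gamma>\<^sub>S\<close> rotates the part \<open>w\<close> of the
  centroid that comes from \<open>S\<close> and fixes the rest. The triangle is nondegenerate because \<open>w \<noteq> 0\<close>: its
  terms have the lengths \<open>d1 / 2 ^ r\<close> for distinct \<open>r\<close>, so the first one is longer than all the
  later ones together (\<open>dyadic_sum_nonzero\<close>).

  It remains to count local triples with \<open>card S\<close> odd. A triple determines \<open>S\<close> as the set of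
  coordinates where its members differ, and exactly one of its three members has \<open>i\<close> at the first
  coordinate of \<open>S\<close>. Taking this member as the representative leaves \<open>3 ^ (k - 1) * 4 ^ (n - k)\<close> words
  for each \<open>S\<close> of size \<open>k\<close>, and summing over \<open>S\<close> gives the binomial sum. Its closed form is the odd
  part of the expansion of \<open>(4 + 3) ^ n\<close>, divided by three.\<close>

section \<open>Rotating symbols and words\<close>

lemma gamma_cube [simp]: "gamma (gamma (gamma x)) = x"
  by (cases x) auto

lemma gamma_eq_Qe_iff [simp]: "gamma x = Qe \<longleftrightarrow> x = Qe"
  by (cases x) auto

lemma gamma_fixed_iff: "gamma x = x \<longleftrightarrow> x = Qe"
  by (cases x) auto

lemma length_gamma_on [simp]: "length (gamma_on S b) = length b"
  by (simp add: gamma_on_def)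

lemma nth_gamma_on [simp]:
  "r < length b \<Longrightarrow> gamma_on S b ! r = (if r \<in> S then gamma (b ! r) else b ! r)"
  by (simp add: gamma_on_def)

lemma gamma_on_cube [simp]: "gamma_on S (gamma_on S (gamma_on S b)) = b"
  by (rule nth_equalityI) auto

lemma supp_gamma_on [simp]: "supp (gamma_on S b) = supp b"
  by (auto simp: supp_def split: if_splits)

lemma gamma_on_in_Delta [simp]: "gamma_on S b \<in> Delta n \<longleftrightarrow> b \<in> Delta n"
  by (simp add: Delta_def)

lemma gamma_on_neq:
  assumes "S \<noteq> {}" "S \<subseteq> supp b"
  shows "gamma_on S b \<noteq> b"
proof -
  obtain r where "r \<in> S" "r < length b" "b ! r \<noteq> Qe"
    using assms by (auto simp: supp_def)
  then have "gamma_on S b ! r \<noteq> b ! r" by (simp add: gamma_fixed_iff)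
  then show ?thesis by metis
qed

lemma local_triple_gamma_on: "local_triple (gamma_on S b) S = local_triple b S"
  by (auto simp: local_triple_def)

lemma local_triple_distinct:
  assumes "S \<noteq> {}" "S \<subseteq> supp b"
  shows "gamma_on S b \<noteq> b" "gamma_on S (gamma_on S b) \<noteq> gamma_on S b"
    "gamma_on S (gamma_on S b) \<noteq> b"
proof -
  show "gamma_on S b \<noteq> b" "gamma_on S (gamma_on S b) \<noteq> gamma_on S b"
    using assms by (simp_all add: gamma_on_neq)
  show "gamma_on S (gamma_on S b) \<noteq> b"
    using gamma_on_neq[of S "gamma_on S (gamma_on S b)"] assms by simp
qed

section \<open>Anticommutation\<close>

lemma fst_sym_mult_swap:
  "fst (sym_mult x y) = (if x \<noteq> Qe \<and> y \<noteq> Qe \<and> x \<noteq> y then -1 else 1) * fst (sym_mult y x)"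
  by (cases x; cases y) auto

lemma snd_sym_mult_commute: "snd (sym_mult x y) = snd (sym_mult y x)"
  by (cases x; cases y) auto

lemma fst_sym_mult_nonzero: "fst (sym_mult x y) \<noteq> 0"
  by (cases x; cases y) auto

lemma word_mult_eq:
  assumes "length a = length b"
  shows "word_mult a b = (\<Prod>r<length b. fst (sym_mult (a ! r) (b ! r)),
     map (\<lambda>r. snd (sym_mult (a ! r) (b ! r))) [0..<length b])"
  using assms
  by (auto simp: word_mult_def prod.list_conv_set_nth atLeast0LessThan
      intro!: prod.cong nth_equalityI)

text \<open>Swapping two quaternion units changes the sign exactly when they are distinct and both
  different from the identity, and it never changes the underlying symbol. Hence only the parity
  of the number of clashing coordinates matters.\<close>

lemma anticommute_iff_odd_clashes:
  assumes "length a = length b"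
  shows "anticommute a b \<longleftrightarrow>
    odd (card {r. r < length b \<and> a ! r \<noteq> Qe \<and> b ! r \<noteq> Qe \<and> a ! r \<noteq> b ! r})"
    (is "_ \<longleftrightarrow> odd (card ?C)")
proof -
  define p where "p = (\<Prod>r<length b. fst (sym_mult (b ! r) (a ! r)))"
  have "p \<noteq> 0" by (simp add: p_def fst_sym_mult_nonzero)
  have "(\<Prod>r<length b. fst (sym_mult (a ! r) (b ! r))) =
      (\<Prod>r<length b. (if r \<in> ?C then -1 else 1) * fst (sym_mult (b ! r) (a ! r)))"
    by (intro prod.cong refl) (subst fst_sym_mult_swap, auto)
  also have "\<dots> = (\<Prod>r<length b. if r \<in> ?C then -1 else 1) * p"
    by (simp add: prod.distrib p_def)
  also have "(\<Prod>r<length b. if r \<in> ?C then -1 else 1) = (\<Prod>r\<in>?C. (-1::int))"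
    by (rule prod.mono_neutral_cong_right) auto
  also have "\<dots> = (-1) ^ card ?C" by simp
  finally have "fst (word_mult a b) = (-1) ^ card ?C * fst (word_mult b a)"
    using assms by (simp add: word_mult_eq p_def)
  moreover have "fst (word_mult b a) \<noteq> 0"
    using \<open>p \<noteq> 0\<close> assms by (simp add: word_mult_eq p_def)
  moreover have "snd (word_mult a b) = snd (word_mult b a)"
    using assms by (simp add: word_mult_eq snd_sym_mult_commute)
  ultimately show ?thesis
    by (cases "even (card ?C)") (auto simp: anticommute_def signed_neg_def prod_eq_iff)
qed

lemma anticommute_sym: "anticommute a b \<longleftrightarrow> anticommute b a"
  by (auto simp: anticommute_def signed_neg_def prod_eq_iff)

lemma anticommute_gamma_on:
  assumes "S \<subseteq> supp b"
  shows "anticommute b (gamma_on S b) \<longleftrightarrow> odd (card S)"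
proof -
  have "{r. r < length b \<and> b ! r \<noteq> Qe \<and> gamma_on S b ! r \<noteq> Qe \<and> b ! r \<noteq> gamma_on S b ! r} = S"
    using assms by (auto simp: supp_def gamma_fixed_iff[THEN eq_iff_swap] split: if_splits)
  then show ?thesis by (simp add: anticommute_iff_odd_clashes)
qed

text \<open>Since \<open>\<gamma>\<^sub>S\<close> has order three, each pair of members of a local triple consists of a word and its
  image under \<open>\<gamma>\<^sub>S\<close>; so the three anticommutation conditions coincide.\<close>

lemma anticommute_in_local_triple:
  assumes "S \<subseteq> supp b" "x \<in> local_triple b S" "y \<in> local_triple b S" "x \<noteq> y"
  shows "anticommute x y \<longleftrightarrow> odd (card S)"
proof -
  have "y = gamma_on S x \<or> x = gamma_on S y" and "S \<subseteq> supp x" "S \<subseteq> supp y"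
    using assms by (auto simp: local_triple_def)
  then show ?thesis
    using anticommute_gamma_on anticommute_sym by metis
qed

section \<open>Local triples are equilateral\<close>

text \<open>The rotation of the plane by \<open>-120\<close> degrees.\<close>

definition turn :: "real^2 \<Rightarrow> real^2" where
  "turn x = vector [- x $ 1 / 2 + sqrt 3 / 2 * x $ 2, - sqrt 3 / 2 * x $ 1 - x $ 2 / 2]"

lemma linear_turn: "linear turn"
  by (rule linearI) (simp_all add: turn_def vec_eq_iff forall_2 field_simps)

lemma norm_turn [simp]: "norm (turn x) = norm x"
proof -
  have "turn x \<bullet> turn x = x \<bullet> x"
    by (simp add: inner_vec_def sum_2 turn_def field_simps)
  then show ?thesis by (simp add: norm_eq)
qed

lemma turn_orbit_sum: "x + turn x + turn (turn x) = 0"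
  by (simp add: turn_def vec_eq_iff forall_2 field_simps)

lemma turn_cube: "turn (turn (turn x)) = x"
proof -
  have "(x + turn x + turn (turn x)) - (turn x + turn (turn x) + turn (turn (turn x))) = 0"
    by (simp only: turn_orbit_sum diff_self)
  then show ?thesis by (simp add: algebra_simps)
qed

lemma v_explicit:
  "v Qi = vector [- sqrt 3 / 2, - 1 / 2]" "v Qj = vector [0, 1]" "v Qk = vector [sqrt 3 / 2, - 1 / 2]"
proof -
  have i: "210 * pi / 180 = pi / 6 + pi" and j: "90 * pi / 180 = pi / 2"
    and k: "330 * pi / 180 = 2 * pi - pi / 6"
    by simp_all
  show "v Qi = vector [- sqrt 3 / 2, - 1 / 2]"
    by (simp only: v.simps i cos_periodic_pi sin_periodic_pi cos_30 sin_30) simp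
  show "v Qj = vector [0, 1]"
    by (simp only: v.simps j cos_pi_half sin_pi_half)
  show "v Qk = vector [sqrt 3 / 2, - 1 / 2]"
    by (simp only: v.simps k cos_2pi_minus sin_2pi_minus cos_30 sin_30) simp
qed

text \<open>The directions of \<open>i\<close>, \<open>j\<close>, \<open>k\<close> are 210, 90 and -30 degrees, so \<open>\<gamma>\<close> acts on them by \<open>turn\<close>;
  the null vector of \<open>e\<close> is fixed by both.\<close>

lemma v_gamma: "v (gamma c) = turn (v c)"
  by (cases c) (simp_all add: v_explicit del: v.simps(1-3), simp_all add: turn_def vec_eq_iff forall_2)

lemma norm_v: "c \<noteq> Qe \<Longrightarrow> norm (v c) = 1"
  by (cases c) (simp_all add: v_explicit norm_eq_1 inner_vec_def sum_2 power2_eq_square del: v.simps(1-3))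

lemma geometric_tail_less:
  fixes m n :: nat
  assumes "m < n"
  shows "(\<Sum>r\<in>{m<..<n}. 1 / 2 ^ r) < (1 / 2 ^ m :: real)"
proof -
  have "(\<Sum>r\<in>{m<..<Suc m + t}. 1 / 2 ^ r) = (1 / 2 ^ m - 1 / 2 ^ (m + t) :: real)" for t
  proof (induction t)
    case 0
    have "{m<..<Suc m} = {}" by auto
    then show ?case by simp
  next
    case (Suc t)
    have "{m<..<Suc m + Suc t} = insert (Suc m + t) {m<..<Suc m + t}" by auto
    then have "(\<Sum>r\<in>{m<..<Suc m + Suc t}. 1 / 2 ^ r :: real)
        = 1 / 2 ^ (Suc m + t) + (\<Sum>r\<in>{m<..<Suc m + t}. 1 / 2 ^ r)"
      by simp
    also have "\<dots> = 1 / 2 ^ m - 1 / 2 ^ (m + Suc t)"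
      by (subst Suc) (simp add: field_simps)
    finally show ?case .
  qed
  from this[of "n - Suc m"] assms show ?thesis by simp
qed

text \<open>The term with the least index cannot be cancelled by the others.\<close>

lemma dyadic_sum_nonzero:
  fixes u :: "nat \<Rightarrow> 'a::real_normed_vector" and n :: nat
  assumes "S \<noteq> {}" "S \<subseteq> {..<n}" "d > 0" and norm: "\<And>r. r \<in> S \<Longrightarrow> norm (u r) = d / 2 ^ r"
  shows "(\<Sum>r\<in>S. u r) \<noteq> 0"
proof
  assume zero: "(\<Sum>r\<in>S. u r) = 0"
  have fin: "finite S" using assms(2) finite_subset by blast
  define m where "m = Min S"
  have m: "m \<in> S" "m < n" and ge: "\<And>r. r \<in> S \<Longrightarrow> m \<le> r"
    using fin assms(1,2) by (auto simp: m_def intro: Min_in)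
  have "u m = - (\<Sum>r\<in>S - {m}. u r)"
    using zero fin m by (simp add: sum.remove eq_neg_iff_add_eq_0)
  then have "d / 2 ^ m = norm (\<Sum>r\<in>S - {m}. u r)"
    using norm[OF m(1)] by simp
  also have "\<dots> \<le> (\<Sum>r\<in>S - {m}. d / 2 ^ r)"
    by (rule sum_norm_le) (simp add: norm)
  also have "\<dots> \<le> (\<Sum>r\<in>{m<..<n}. d / 2 ^ r)"
  proof (rule sum_mono2)
    show "S - {m} \<subseteq> {m<..<n}"
      using ge assms(2) by (force simp: order_less_le)
  qed (use assms(3) in auto)
  also have "\<dots> = d * (\<Sum>r\<in>{m<..<n}. 1 / 2 ^ r)"
    by (simp add: sum_distrib_left)
  also have "\<dots> < d * (1 / 2 ^ m)"
    using geometric_tail_less[OF m(2)] assms(3) by (intro mult_strict_left_mono) auto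
  finally show False by simp
qed

text \<open>The contribution of the coordinates in \<open>S\<close> to the centroid of \<open>b\<close>, which is what \<open>\<gamma>\<^sub>S\<close> moves.\<close>

definition moving_part :: "real \<Rightarrow> nat set \<Rightarrow> word \<Rightarrow> real^2" where
  "moving_part d1 S b = (\<Sum>r\<in>S. (sgn_at b r * (d1 / 2 ^ r)) *\<^sub>R v (b ! r))"

lemma sgn_at_gamma_on: "r < length b \<Longrightarrow> sgn_at (gamma_on S b) r = sgn_at b r"
proof -
  assume "r < length b"
  then have "{s. s < r \<and> gamma_on S b ! s = Qe} = {s. s < r \<and> b ! s = Qe}"
    by (auto split: if_splits)
  then show ?thesis by (simp add: sgn_at_def)
qed

lemma moving_part_gamma_on:
  assumes "S \<subseteq> {..<length b}"
  shows "moving_part d1 S (gamma_on S b) = turn (moving_part d1 S b)"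
  unfolding moving_part_def linear_sum[OF linear_turn]
  using assms
  by (intro sum.cong refl) (auto simp: sgn_at_gamma_on v_gamma linear_cmul[OF linear_turn])

lemma centroid_gamma_on:
  assumes "S \<subseteq> {..<length b}"
  shows "centroid d1 (gamma_on S b) =
    centroid d1 b + (turn (moving_part d1 S b) - moving_part d1 S b)"
proof -
  have split: "centroid d1 c = (\<Sum>r\<in>{..<length b} - S. (sgn_at c r * (d1 / 2 ^ r)) *\<^sub>R v (c ! r))
      + moving_part d1 S c" if "length c = length b" for c
    unfolding centroid_def moving_part_def that by (rule sum.subset_diff) (use assms in auto)
  have "(\<Sum>r\<in>{..<length b} - S. (sgn_at (gamma_on S b) r * (d1 / 2 ^ r)) *\<^sub>R v (gamma_on S b ! r))
      = (\<Sum>r\<in>{..<length b} - S. (sgn_at b r * (d1 / 2 ^ r)) *\<^sub>R v (b ! r))"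
    by (intro sum.cong refl) (auto simp: sgn_at_gamma_on)
  then show ?thesis
    using split[of b] split[of "gamma_on S b"] assms by (simp add: moving_part_gamma_on)
qed

lemma moving_part_nonzero:
  assumes "d1 > 0" "S \<noteq> {}" "S \<subseteq> supp b"
  shows "moving_part d1 S b \<noteq> 0"
  unfolding moving_part_def
proof (rule dyadic_sum_nonzero[where n = "length b" and d = d1])
  show "S \<subseteq> {..<length b}" using assms(3) by (auto simp: supp_def)
  fix r assume "r \<in> S"
  then have "norm (v (b ! r)) = 1" using assms(3) by (intro norm_v) (auto simp: supp_def)
  then show "norm ((sgn_at b r * (d1 / 2 ^ r)) *\<^sub>R v (b ! r)) = d1 / 2 ^ r"
    using assms(1) by (simp add: sgn_at_def abs_mult power_abs)
qed (use assms in auto)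

text \<open>Each side of the triangle is the preceding one, rotated by \<open>turn\<close>; so the sides have equal
  lengths. The first side \<open>turn w - w\<close> vanishes only for \<open>w = 0\<close>, because a fixed point of \<open>turn\<close> is
  a third of the sum of its orbit, which is \<open>0\<close>.\<close>

lemma local_triple_in_Eset:
  assumes "d1 > 0" "b \<in> Delta n" "S \<noteq> {}" "S \<subseteq> supp b"
  shows "local_triple b S \<in> Eset d1 n"
proof -
  have S: "S \<subseteq> {..<length b}" using assms(4) by (auto simp: supp_def)
  define w where "w = moving_part d1 S b"
  have "w \<noteq> 0" using moving_part_nonzero assms by (simp add: w_def)
  define step where "step = turn w - w"
  have step_turn: "turn step = turn (turn w) - turn w"
    and step_turn2: "turn (turn step) = w - turn (turn w)"
    by (simp_all add: step_def linear_diff[OF linear_turn] turn_cube)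
  have c1: "centroid d1 (gamma_on S b) = centroid d1 b + step"
    using S by (simp add: centroid_gamma_on w_def step_def)
  have c2: "centroid d1 (gamma_on S (gamma_on S b)) = centroid d1 (gamma_on S b) + turn step"
    using S by (simp add: centroid_gamma_on moving_part_gamma_on step_turn w_def)
  have c3: "centroid d1 b = centroid d1 (gamma_on S (gamma_on S b)) + turn (turn step)"
    using S centroid_gamma_on[of S "gamma_on S (gamma_on S b)" d1]
    by (simp add: moving_part_gamma_on step_turn2 w_def turn_cube)
  have "step \<noteq> 0"
  proof
    assume "step = 0"
    then have "turn w = w" by (simp add: step_def)
    with turn_orbit_sum[of w] have "w + w + w = 0" by simp
    then have "3 *\<^sub>R w = 0" by (simp add: vec_eq_iff)
    with \<open>w \<noteq> 0\<close> show False by simp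
  qed
  have "dist (centroid d1 b) (centroid d1 (gamma_on S b)) = norm step"
    by (simp add: c1 dist_norm)
  moreover have "dist (centroid d1 (gamma_on S b)) (centroid d1 (gamma_on S (gamma_on S b))) = norm step"
    by (simp add: c2 dist_norm)
  moreover have "dist (centroid d1 (gamma_on S (gamma_on S b))) (centroid d1 b) = norm step"
    by (subst c3) (simp add: dist_norm)
  ultimately have "equilateral (centroid d1 b) (centroid d1 (gamma_on S b))
      (centroid d1 (gamma_on S (gamma_on S b)))"
    using \<open>step \<noteq> 0\<close> by (auto simp: equilateral_def c1)
  then show ?thesis
    using local_triple_distinct[OF assms(3,4)] assms(2)
    unfolding Eset_def local_triple_def
    by (intro CollectI exI[of _ b] exI[of _ "gamma_on S b"] exI[of _ "gamma_on S (gamma_on S b)"]) auto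
qed

lemma local_triple_in_AC_iff:
  assumes "d1 > 0" "b \<in> Delta n" "S \<noteq> {}" "S \<subseteq> supp b"
  shows "local_triple b S \<in> AC d1 n \<longleftrightarrow> odd (card S)"
proof
  note distinct = local_triple_distinct[OF assms(3,4)]
  assume "local_triple b S \<in> AC d1 n"
  then obtain x y z where T: "local_triple b S = {x, y, z}" and "anticommute x y"
    by (auto simp: AC_def)
  have "card {x, y, z} = 3"
    using distinct unfolding T[symmetric] local_triple_def by (simp add: card_insert_if)
  then have "x \<noteq> y" by (auto simp: card_insert_if split: if_splits)
  then show "odd (card S)"
    using anticommute_in_local_triple[OF assms(4)] T \<open>anticommute x y\<close> by auto
next
  note distinct = local_triple_distinct[OF assms(3,4)]
  assume "odd (card S)"
  then have "anticommute x y"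
    if "x \<in> local_triple b S" "y \<in> local_triple b S" "x \<noteq> y" for x y
    using anticommute_in_local_triple[OF assms(4) that] by simp
  with distinct show "local_triple b S \<in> AC d1 n"
    using local_triple_in_Eset[OF assms] unfolding AC_def local_triple_def
    by (intro CollectI conjI exI[of _ b] exI[of _ "gamma_on S b"] exI[of _ "gamma_on S (gamma_on S b)"])
       (auto simp: eq_commute)
qed

section \<open>Counting local triples by representatives\<close>

text \<open>A local triple with support \<open>S\<close> is represented by its member with \<open>i\<close> at the first coordinate
  of \<open>S\<close>.\<close>

definition rep_words :: "nat \<Rightarrow> nat set \<Rightarrow> word set" where
  "rep_words n S = {b \<in> Delta n. S \<subseteq> supp b \<and> b ! Min S = Qi}"

definition odd_subsets :: "nat \<Rightarrow> nat set set" where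
  "odd_subsets n = {S. S \<subseteq> {..<n} \<and> odd (card S)}"

lemma odd_subsets_D:
  assumes "S \<in> odd_subsets n"
  shows "S \<subseteq> {..<n}" "odd (card S)" "finite S" "S \<noteq> {}" "Min S \<in> S" "Min S < n"
proof -
  show a: "S \<subseteq> {..<n}" "odd (card S)" using assms by (auto simp: odd_subsets_def)
  show b: "finite S" using a finite_subset by blast
  show c: "S \<noteq> {}" using a by auto
  show d: "Min S \<in> S" using b c by (rule Min_in)
  then show "Min S < n" using a by auto
qed

text \<open>Repeated application of \<open>\<gamma>\<close> takes any imaginary unit to \<open>i\<close>, and it does not change the
  triple; so every triple has a representative.\<close>

lemma AC_Lset_eq_image:
  assumes "d1 > 0"
  shows "AC d1 n \<inter> Lset n = (\<lambda>(S, b). local_triple b S) ` Sigma (odd_subsets n) (rep_words n)"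
    (is "_ = ?R")
proof (intro subset_antisym subsetI)
  fix T assume "T \<in> AC d1 n \<inter> Lset n"
  then obtain b S where T: "T = local_triple b S" and b: "b \<in> Delta n" "S \<noteq> {}" "S \<subseteq> supp b"
    and "T \<in> AC d1 n"
    by (auto simp: Lset_def)
  then have "odd (card S)" using local_triple_in_AC_iff[OF assms] by blast
  then have S: "S \<in> odd_subsets n"
    using b by (auto simp: odd_subsets_def supp_def Delta_def)
  note Min = odd_subsets_D(5,6)[OF S]
  have "\<exists>c \<in> {b, gamma_on S b, gamma_on S (gamma_on S b)}. c ! Min S = Qi"
  proof -
    have "Min S < length b" "b ! Min S \<noteq> Qe" using Min b by (auto simp: supp_def)
    then show ?thesis using Min by (cases "b ! Min S") auto
  qed
  then obtain c where c: "c \<in> {b, gamma_on S b, gamma_on S (gamma_on S b)}" "c ! Min S = Qi"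
    by blast
  then have "local_triple c S = T" "c \<in> rep_words n S"
    using b T by (auto simp: local_triple_gamma_on rep_words_def)
  then show "T \<in> ?R" using S by force
next
  fix T assume "T \<in> ?R"
  then obtain S b where "T = local_triple b S" "S \<in> odd_subsets n" "b \<in> rep_words n S" by auto
  then show "T \<in> AC d1 n \<inter> Lset n"
    using local_triple_in_AC_iff[OF assms, of b n S] odd_subsets_D[of S n]
    by (auto simp: rep_words_def Lset_def)
qed

lemma local_triple_determines_support:
  assumes "S \<subseteq> supp b"
  shows "S = {r. r < length b \<and> (\<exists>x \<in> local_triple b S. \<exists>y \<in> local_triple b S. x ! r \<noteq> y ! r)}"
proof (intro set_eqI iffI CollectI conjI)
  fix r assume "r \<in> S"
  then have "r < length b" "gamma_on S b ! r \<noteq> b ! r"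
    using assms by (auto simp: supp_def gamma_fixed_iff)
  then show "r < length b" "\<exists>x \<in> local_triple b S. \<exists>y \<in> local_triple b S. x ! r \<noteq> y ! r"
    by (auto simp: local_triple_def)
next
  fix r assume "r \<in> {r. r < length b \<and> (\<exists>x \<in> local_triple b S. \<exists>y \<in> local_triple b S. x ! r \<noteq> y ! r)}"
  then obtain x y where "r < length b" "x \<in> local_triple b S" "y \<in> local_triple b S" "x ! r \<noteq> y ! r"
    by blast
  moreover have "z ! r = b ! r" if "r \<notin> S" "r < length b" "z \<in> local_triple b S" for z
    using that by (auto simp: local_triple_def)
  ultimately show "r \<in> S" by metis
qed

text \<open>The representative is unique, since the members of a triple carry \<open>i\<close>, \<open>j\<close> and \<open>k\<close>, each once,
  at every coordinate of \<open>S\<close>.\<close>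

lemma inj_on_local_triple:
  "inj_on (\<lambda>(S, b). local_triple b S) (Sigma (odd_subsets n) (rep_words n))"
proof (rule inj_onI, clarsimp)
  fix S b S' b'
  assume S: "S \<in> odd_subsets n" "S' \<in> odd_subsets n"
    and b: "b \<in> rep_words n S" "b' \<in> rep_words n S'"
    and eq: "local_triple b S = local_triple b' S'"
  have len: "length b = n" "length b' = n" using b by (auto simp: rep_words_def Delta_def)
  have "S = S'"
    using local_triple_determines_support[of S b] local_triple_determines_support[of S' b']
      b eq len by (simp add: rep_words_def)
  have "b' \<in> local_triple b S" by (simp add: eq) (simp add: local_triple_def)
  moreover have "b' ! Min S = Qi" "b ! Min S = Qi"
    using b \<open>S = S'\<close> by (auto simp: rep_words_def)
  ultimately have "b = b'"
    using odd_subsets_D(5,6)[OF S(1)] len by (auto simp: local_triple_def)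
  with \<open>S = S'\<close> show "S = S' \<and> b = b'" by simp
qed

lemma card_lists_pointwise:
  "card {b. length b = n \<and> (\<forall>r<n. b ! r \<in> A r)} = (\<Prod>r<n. card (A r))"
proof (induction n)
  case 0
  have "{b. length b = 0 \<and> (\<forall>r<0. b ! r \<in> A r)} = {[]}" by auto
  then show ?case by simp
next
  case (Suc n)
  let ?B = "\<lambda>n. {b. length b = n \<and> (\<forall>r<n. b ! r \<in> A r)}"
  have "?B (Suc n) = (\<lambda>(b, x). b @ [x]) ` (?B n \<times> A n)"
  proof (intro subset_antisym subsetI)
    fix b assume b: "b \<in> ?B (Suc n)"
    then have "b = take n b @ [b ! n]"
      by (simp add: take_Suc_conv_app_nth[symmetric])
    moreover have "take n b \<in> ?B n" "b ! n \<in> A n" using b by auto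
    ultimately show "b \<in> (\<lambda>(b, x). b @ [x]) ` (?B n \<times> A n)"
      by (intro image_eqI[of _ _ "(take n b, b ! n)"]) simp_all
  next
    fix b assume "b \<in> (\<lambda>(b, x). b @ [x]) ` (?B n \<times> A n)"
    then obtain c x where "b = c @ [x]" "length c = n" "\<And>r. r < n \<Longrightarrow> c ! r \<in> A r" "x \<in> A n"
      by auto
    then show "b \<in> ?B (Suc n)" by (simp add: nth_append less_Suc_eq)
  qed
  moreover have "inj_on (\<lambda>(b, x). b @ [x]) (?B n \<times> A n)"
    by (rule inj_onI) (simp add: split_beta prod_eq_iff)
  ultimately have "card (?B (Suc n)) = card (?B n) * card (A n)"
    by (simp only: card_image card_cartesian_product)
  then show ?case by (simp only: Suc.IH prod.lessThan_Suc)
qed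

lemma UNIV_sym: "UNIV = {Qi, Qj, Qk, Qe}"
proof (rule set_eqI)
  show "x \<in> UNIV \<longleftrightarrow> x \<in> {Qi, Qj, Qk, Qe}" for x by (cases x) auto
qed

lemma card_UNIV_sym: "card (UNIV :: sym set) = 4"
  by (simp add: UNIV_sym)

lemma card_nonidentity_syms: "card (- {Qe}) = 3"
  by (simp add: Compl_eq_Diff_UNIV UNIV_sym)

text \<open>One choice at the first coordinate of \<open>S\<close>, three at its other coordinates, four outside \<open>S\<close>.\<close>

lemma card_rep_words:
  assumes "S \<in> odd_subsets n"
  shows "card (rep_words n S) = 3 ^ (card S - 1) * 4 ^ (n - card S)"
proof -
  note S = odd_subsets_D[OF assms]
  define A where "A r = (if r = Min S then {Qi} else if r \<in> S then - {Qe} else UNIV)" for r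
  have "rep_words n S = {b. length b = n \<and> (\<forall>r<n. b ! r \<in> A r)}"
    using S(1,5,6) by (auto simp: rep_words_def Delta_def supp_def A_def split: if_splits)
  then have "card (rep_words n S) = (\<Prod>r<n. card (A r))"
    by (simp add: card_lists_pointwise)
  also have "\<dots> = (\<Prod>r\<in>S - {Min S}. 3) * (\<Prod>r\<in>{..<n} - S. 4)"
  proof -
    have "(\<Prod>r<n. card (A r)) = (\<Prod>r\<in>S. card (A r)) * (\<Prod>r\<in>{..<n} - S. card (A r))"
      using S(1) by (subst mult.commute) (simp add: prod.subset_diff)
    also have "(\<Prod>r\<in>S. card (A r)) = card (A (Min S)) * (\<Prod>r\<in>S - {Min S}. card (A r))"
      by (rule prod.remove) (use S in auto)
    also have "(\<Prod>r\<in>S - {Min S}. card (A r)) = (\<Prod>r\<in>S - {Min S}. 3)"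
      by (intro prod.cong) (auto simp: A_def card_nonidentity_syms)
    also have "(\<Prod>r\<in>{..<n} - S. card (A r)) = (\<Prod>r\<in>{..<n} - S. 4)"
      using S(5) by (intro prod.cong) (auto simp: A_def card_UNIV_sym)
    finally show ?thesis by (simp add: A_def)
  qed
  finally show ?thesis
    using S by (simp add: card_Diff_subset)
qed

lemma sum_over_odd_subsets:
  "(\<Sum>S\<in>odd_subsets n. f (card S)) = (\<Sum>k | 1 \<le> k \<and> k \<le> n \<and> odd k. (n choose k) * f k)"
proof -
  let ?K = "{k. 1 \<le> k \<and> k \<le> n \<and> odd k}"
  have "card S \<in> ?K" if "S \<in> odd_subsets n" for S
    using odd_subsets_D[OF that] card_mono[of "{..<n}" S] by (auto simp: Suc_le_eq card_gt_0_iff)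
  then have "card ` odd_subsets n \<subseteq> ?K" by auto
  moreover have "finite (odd_subsets n)" by (simp add: odd_subsets_def)
  ultimately have "(\<Sum>S\<in>odd_subsets n. f (card S))
      = (\<Sum>k\<in>?K. \<Sum>S | S \<in> odd_subsets n \<and> card S = k. f (card S))"
    by (intro sum.group[symmetric]) auto
  also have "\<dots> = (\<Sum>k\<in>?K. (n choose k) * f k)"
  proof (intro sum.cong refl)
    fix k assume "k \<in> ?K"
    then have "{S \<in> odd_subsets n. card S = k} = {S. S \<subseteq> {..<n} \<and> card S = k}"
      by (auto simp: odd_subsets_def)
    then show "(\<Sum>S | S \<in> odd_subsets n \<and> card S = k. f (card S)) = (n choose k) * f k"
      by (simp add: n_subsets)
  qed
  finally show ?thesis .
qed

lemma card_AC_Lset: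
  assumes "d1 > 0"
  shows "card (AC d1 n \<inter> Lset n)
    = (\<Sum>k | 1 \<le> k \<and> k \<le> n \<and> odd k. (n choose k) * 3 ^ (k - 1) * 4 ^ (n - k))"
proof -
  have fin: "finite (rep_words n S)" if "S \<in> odd_subsets n" for S
    using card_rep_words[OF that] by (intro card_ge_0_finite) simp
  have "card (AC d1 n \<inter> Lset n) = card (Sigma (odd_subsets n) (rep_words n))"
    unfolding AC_Lset_eq_image[OF assms] by (rule card_image) (rule inj_on_local_triple)
  also have "\<dots> = (\<Sum>S\<in>odd_subsets n. card (rep_words n S))"
    using fin by (intro card_SigmaI) (auto simp: odd_subsets_def)
  also have "\<dots> = (\<Sum>S\<in>odd_subsets n. 3 ^ (card S - 1) * 4 ^ (n - card S))"
    by (simp add: card_rep_words)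
  also have "\<dots> = (\<Sum>k | 1 \<le> k \<and> k \<le> n \<and> odd k. (n choose k) * (3 ^ (k - 1) * 4 ^ (n - k)))"
    by (rule sum_over_odd_subsets)
  finally show ?thesis by (simp add: mult.assoc)
qed

text \<open>Subtracting the expansion of \<open>(4 - 3) ^ n = 1\<close> from that of \<open>(4 + 3) ^ n\<close> cancels the even terms
  and doubles the odd ones.\<close>

lemma odd_binomial_sum:
  "real (\<Sum>k | 1 \<le> k \<and> k \<le> n \<and> odd k. (n choose k) * 3 ^ (k - 1) * 4 ^ (n - k)) = (7 ^ n - 1) / 6"
proof -
  let ?K = "{k. 1 \<le> k \<and> k \<le> n \<and> odd k}"
  define g where "g k = real (n choose k) * 3 ^ k * 4 ^ (n - k)" for k
  have "(7::real) ^ n - 1 = (3 + 4) ^ n - (- 3 + 4) ^ n" by simp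
  also have "\<dots> = (\<Sum>k\<le>n. real (n choose k) * 3 ^ k * 4 ^ (n - k)
      - real (n choose k) * (- 3) ^ k * 4 ^ (n - k))"
    by (simp only: binomial_ring sum_subtractf)
  also have "\<dots> = (\<Sum>k\<in>?K. 2 * g k)"
    by (rule sum.mono_neutral_cong_right) (auto simp: g_def Suc_le_eq intro: gr0I)
  also have "\<dots> = (\<Sum>k\<in>?K. 6 * (real (n choose k) * 3 ^ (k - 1) * 4 ^ (n - k)))"
    by (intro sum.cong refl) (auto simp: g_def power_eq_if)
  finally have "(7::real) ^ n - 1 = 6 * (\<Sum>k\<in>?K. real (n choose k) * 3 ^ (k - 1) * 4 ^ (n - k))"
    by (simp only: sum_distrib_left)
  then show ?thesis by simp
qed

theorem corollary10p7:
  fixes d1 :: real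
  assumes "d1 > 0"
  shows "(\<forall>n::nat. n \<ge> 1 \<longrightarrow>
            card (AC d1 n \<inter> Lset n)
              = (\<Sum>k | 1 \<le> k \<and> k \<le> n \<and> odd k. (n choose k) * 3 ^ (k - 1) * 4 ^ (n - k))
          \<and> real (\<Sum>k | 1 \<le> k \<and> k \<le> n \<and> odd k. (n choose k) * 3 ^ (k - 1) * 4 ^ (n - k))
              = (7 ^ n - 1) / 6)
       \<and> map (\<lambda>n. card (AC d1 n \<inter> Lset n)) [1, 2, 3, 4, 5, 6, 7, 8]
           = [1, 8, 57, 400, 2801, 19608, 137257, 960800]"
proof -
  have "real (card (AC d1 n \<inter> Lset n)) = (7 ^ n - 1) / 6" for n
    unfolding card_AC_Lset[OF assms] by (rule odd_binomial_sum)
  then have value_if: "card (AC d1 n \<inter> Lset n) = m" if "(7 ^ n - 1) / 6 = real m" for n m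
    using that by (metis of_nat_eq_iff)
  have "map (\<lambda>n. card (AC d1 n \<inter> Lset n)) [1, 2, 3, 4, 5, 6, 7, 8]
      = [1, 8, 57, 400, 2801, 19608, 137257, 960800]"
    by (simp only: list.map list.inject, intro conjI refl; rule value_if, simp)
  then show ?thesis
    using card_AC_Lset[OF assms] odd_binomial_sum by blast
qed

end
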